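(* Let $F_\varphi$, $\varphi\in\mathbb{R}$, be the associated family of an S-isothermic minimal surface $F_0$. Then, like $F_0$, each surface $F_\varphi$ consists of touching spheres, and the radii of the spheres do not depend on $\varphi$: there are radii $R(x)>0$, independent of $\varphi$, such that for every $\varphi$ the spheres with centres $F_\varphi(x)$ and radii $R(x)$, $x$ an $s$-labelled vertex, touch externally for every pair of $s$-labelled vertices $x_1,x_2$ which are the neighbours of a common black vertex $y$. Moreover, in the generic case when the quad-graph has $\mathbb{Z}^2$-combinatorics (all interior vertices have degree 4), there are also circles through the points of contact, as is the case for $F_0$, and the normals of the circles do not depend on $\varphi$: for every interior $c$-labelled vertex $z$ there is a unit vector $n_z$, independent of $\varphi$, such that for every $\varphi$ there is a circle, lying in a plane orthogonal to $n_z$, that passes through the points of contact (of the surface $F_\varphi$) corresponding to the black neighbours of $z$.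
   Context: A quad-graph is a cell decomposition of an oriented two-dimensional manifold (possibly with boundary) all of whose faces are quadrilaterals. An S-quad-graph is a quad-graph $Q$ whose interior vertices have even degree, together with a bipartite colouring of the vertices into black and white vertices (edges join black to white) such that interior black vertices have degree 4, and a labelling of the white vertices by $c$ ("circle") or $s$ ("sphere") such that each quadrilateral has exactly one $c$-labelled and one $s$-labelled white vertex. Let $Q$ be a simply connected S-quad-graph. Its edges can be labelled $+$ and $-$ such that in each quadrilateral opposite edges have equal labels and adjacent edges have different labels; fix such a labelling. (The two edges joining a black vertex to its $s$-labelled neighbours have the same label.) Koebe surface: a Koebe polyhedron on $Q$ consists of points $K(y)\in S^2$ for black vertices $y$ ($S^2$ the unit sphere in $\mathbb{R}^3$), circles contained in $S^2$ for the $c$-labelled vertices and spheres intersecting $S^2$ orthogonally for the $s$-labelled vertices, such that each $K(y)$ lies on the circles and spheres of the white neighbours of $y$; the two spheres of the $s$-labelled neighbours of $y$ touch externally in $K(y)$, and the two circles of the $c$-labelled neighbours of $y$ touch in $K(y)$; and the circle and the sphere belonging to the same quadrilateral intersect orthogonally. For white $x$ let $K(x)$ be the centre of its circle or sphere, and for $s$-labelled $x$ let $r(x)$ be the radius of its sphere. For $s$-labelled neighbours $x_1,x_2$ of a black vertex $y$, the segment from $K(x_1)$ to $K(x_2)$ is an edge of the Koebe polyhedron; it has length $r(x_1)+r(x_2)$ and is tangent to $S^2$ at $K(y)$. S-isothermic minimal surface $F_0$: the dual of the Koebe surface, defined up to translation by $\Delta F_0=\pm\Delta K/\|\Delta K\|^2$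 along each edge of $Q$, with sign given by the edge label ($\Delta$ denotes the difference of the values at the end vertices). Thus for $s$-labelled neighbours $x_1,x_2$ of a black vertex $y$: $F_0(x_2)-F_0(x_1)=\pm\frac{1}{r(x_1)r(x_2)}\,(K(x_2)-K(x_1))$; the sphere of $F_0$ at $x$ has radius $1/r(x)$. Associated family: before dualizing, rotate each edge of the Koebe polyhedron by the same angle $\varphi$ (counterclockwise with respect to the outward normal) in the plane tangent to $S^2$ at the point where the edge touches $S^2$. That is, $F_\varphi$ is the map from the $s$-labelled vertices to $\mathbb{R}^3$ defined up to translation by $F_\varphi(x_2)-F_\varphi(x_1)=\pm\frac{1}{r(x_1)r(x_2)}\,\rho_{y}^{\varphi}(K(x_2)-K(x_1))$, where $\rho_y^\varphi$ is the rotation by $\varphi$ in the tangent plane of $S^2$ at $K(y)$, $y$ is the black vertex between $x_1$ and $x_2$, and the sign is the label of the edges $x_1y$, $yx_2$. (These differences are consistent and define $F_\varphi$.) The point of contact corresponding to $y$ is the point on the segment $F_\varphi(x_1)F_\varphi(x_2)$ where the two spheres touch. *)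

theory Defs
  imports "HOL-Analysis.Analysis"
begin

section \<open>Cell decompositions into quadrilaterals\<close>

text \<open>
  A cell decomposition of an oriented surface into quadrilaterals is given by its faces, by the
  vertex at each corner and by the edge at each side of a face. Corners and sides are indexed by
  the type \<^typ>\<open>4\<close> (integers modulo 4) in the cyclic order given by the orientation; side \<open>i\<close>
  runs from corner \<open>i\<close> to corner \<open>i + 1\<close>. Different sides of the faces may be the same edge, so
  that multiple edges are not excluded.
\<close>

record ('v, 'e, 'f) quad_cells =
  faces :: "'f set"
  corner :: "'f \<Rightarrow> 4 \<Rightarrow> 'v"
  side :: "'f \<Rightarrow> 4 \<Rightarrow> 'e"

definition verts :: "('v, 'e, 'f) quad_cells \<Rightarrow> 'v set" where
  "verts Q = {corner Q f i | f i. f \<in> faces Q}"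

definition edges :: "('v, 'e, 'f) quad_cells \<Rightarrow> 'e set" where
  "edges Q = {side Q f i | f i. f \<in> faces Q}"

definition glued :: "('v, 'e, 'f) quad_cells \<Rightarrow> 'f \<times> 4 \<Rightarrow> 'f \<times> 4 \<Rightarrow> bool" where
  "glued Q s t \<longleftrightarrow> fst s \<in> faces Q \<and> fst t \<in> faces Q \<and> s \<noteq> t
     \<and> side Q (fst s) (snd s) = side Q (fst t) (snd t)"

text \<open>
  Glued sides are traversed in opposite directions by their faces (orientability): the initial
  corner of a side is identified with the final corner of the side glued to it.
\<close>

definition corner_glued :: "('v, 'e, 'f) quad_cells \<Rightarrow> 'f \<times> 4 \<Rightarrow> 'f \<times> 4 \<Rightarrow> bool" where
  "corner_glued Q c d \<longleftrightarrow> glued Q c (fst d, snd d - 1)"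

text \<open>
  A gluing of quadrilaterals in which every side is glued to at most one other side, in which
  corners are identified exactly as far as the gluing of the sides forces it, and which is locally
  finite, is a surface with boundary; the neighbourhood of a vertex is then a disc or a half-disc.
\<close>

definition quad_graph :: "('v, 'e, 'f) quad_cells \<Rightarrow> bool" where
  "quad_graph Q \<longleftrightarrow>
     (\<forall>s t u. glued Q s t \<and> glued Q s u \<longrightarrow> t = u)
   \<and> (\<forall>f\<in>faces Q. \<forall>g\<in>faces Q. \<forall>i j.
        corner Q f i = corner Q g j \<longleftrightarrow> equivclp (corner_glued Q) (f, i) (g, j))
   \<and> (\<forall>v. finite {(f, i). f \<in> faces Q \<and> corner Q f i = v})"

definition joins :: "('v, 'e, 'f) quad_cells \<Rightarrow> 'e \<Rightarrow> 'v \<Rightarrow> 'v \<Rightarrow> bool" where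
  "joins Q e a b \<longleftrightarrow>
     (\<exists>f\<in>faces Q. \<exists>i. side Q f i = e \<and> {corner Q f i, corner Q f (i + 1)} = {a, b})"

definition interior_vertex :: "('v, 'e, 'f) quad_cells \<Rightarrow> 'v \<Rightarrow> bool" where
  "interior_vertex Q v \<longleftrightarrow> v \<in> verts Q
     \<and> (\<forall>f\<in>faces Q. \<forall>i. corner Q f i = v \<longrightarrow> (\<exists>s. glued Q (f, i) s) \<and> (\<exists>s. glued Q (f, i - 1) s))"

text \<open>
  The degree is only used for bipartite graphs, where there are no loops, which would have to be
  counted twice.
\<close>

definition degree :: "('v, 'e, 'f) quad_cells \<Rightarrow> 'v \<Rightarrow> nat" where
  "degree Q v = card {e. \<exists>w. joins Q e v w}"


section \<open>Simple connectedness\<close>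

text \<open>
  The fundamental group of the surface is the edge path group of the cell decomposition. A step
  \<open>((f, i), True)\<close> of an edge path traverses side \<open>i\<close> of \<open>f\<close> from corner \<open>i\<close> to corner \<open>i + 1\<close>,
  and \<open>((f, i), False)\<close> traverses it in the opposite direction.
\<close>

definition tail :: "('v, 'e, 'f) quad_cells \<Rightarrow> ('f \<times> 4) \<times> bool \<Rightarrow> 'v" where
  "tail Q d = (case d of ((f, i), b) \<Rightarrow> corner Q f (if b then i else i + 1))"

definition head :: "('v, 'e, 'f) quad_cells \<Rightarrow> ('f \<times> 4) \<times> bool \<Rightarrow> 'v" where
  "head Q d = (case d of ((f, i), b) \<Rightarrow> corner Q f (if b then i + 1 else i))"

fun edge_path :: "('v, 'e, 'f) quad_cells \<Rightarrow> 'v \<Rightarrow> (('f \<times> 4) \<times> bool) list \<Rightarrow> 'v \<Rightarrow> bool" where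
  "edge_path Q a [] b \<longleftrightarrow> a \<in> verts Q \<and> a = b"
| "edge_path Q a (d # w) b \<longleftrightarrow>
     fst (fst d) \<in> faces Q \<and> tail Q d = a \<and> edge_path Q (head Q d) w b"

inductive elementary_homotopy ::
    "('v, 'e, 'f) quad_cells \<Rightarrow> (('f \<times> 4) \<times> bool) list \<Rightarrow> (('f \<times> 4) \<times> bool) list \<Rightarrow> bool"
  for Q where
  same_edge: "glued Q s t \<Longrightarrow>
    elementary_homotopy Q (p @ [(s, b)] @ q) (p @ [(t, \<not> b)] @ q)"
| backtrack: "elementary_homotopy Q (p @ [(s, b), (s, \<not> b)] @ q) (p @ q)"
| around_face: "f \<in> faces Q \<Longrightarrow>
    elementary_homotopy Q (p @ map (\<lambda>i. ((f, i), True)) [0, 1, 2, 3] @ q) (p @ q)"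

definition simply_connected_cells :: "('v, 'e, 'f) quad_cells \<Rightarrow> bool" where
  "simply_connected_cells Q \<longleftrightarrow>
     (\<forall>a\<in>verts Q. \<forall>b\<in>verts Q. \<exists>w. edge_path Q a w b)
   \<and> (\<forall>a w. edge_path Q a w a \<longrightarrow>
        equivclp (\<lambda>p q. edge_path Q a p a \<and> edge_path Q a q a \<and> elementary_homotopy Q p q) w [])"


section \<open>S-quad-graphs\<close>

text \<open>White vertices are those of kind \<open>Circ\<close> (label \<open>c\<close>) or \<open>Sph\<close> (label \<open>s\<close>).\<close>

datatype vertex_kind = Black | Circ | Sph

definition S_quad_graph :: "('v, 'e, 'f) quad_cells \<Rightarrow> ('v \<Rightarrow> vertex_kind) \<Rightarrow> bool" where
  "S_quad_graph Q kind \<longleftrightarrow> quad_graph Q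
   \<and> (\<forall>v. interior_vertex Q v \<longrightarrow> even (degree Q v))
   \<and> (\<forall>e a b. joins Q e a b \<longrightarrow> (kind a = Black \<longleftrightarrow> kind b \<noteq> Black))
   \<and> (\<forall>v. interior_vertex Q v \<and> kind v = Black \<longrightarrow> degree Q v = 4)
   \<and> (\<forall>f\<in>faces Q. (\<exists>!i. kind (corner Q f i) = Circ) \<and> (\<exists>!i. kind (corner Q f i) = Sph))"

definition edge_labelling :: "('v, 'e, 'f) quad_cells \<Rightarrow> ('e \<Rightarrow> real) \<Rightarrow> bool" where
  "edge_labelling Q lab \<longleftrightarrow> (\<forall>e\<in>edges Q. lab e \<in> {1, -1})
   \<and> (\<forall>f\<in>faces Q. \<forall>i. lab (side Q f i) = lab (side Q f (i + 2))
        \<and> lab (side Q f i) \<noteq> lab (side Q f (i + 1)))"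

text \<open>
  The vertices \<open>x1\<close> and \<open>x2\<close> of kind \<open>k\<close> are the ends of two different edges at the black vertex
  \<open>y\<close>; a black vertex on the boundary need not have such a pair.
\<close>

definition neighbour_pair ::
    "('v, 'e, 'f) quad_cells \<Rightarrow> ('v \<Rightarrow> vertex_kind) \<Rightarrow> vertex_kind \<Rightarrow> 'v \<Rightarrow> 'v \<Rightarrow> 'v \<Rightarrow> bool" where
  "neighbour_pair Q kind k y x1 x2 \<longleftrightarrow> kind y = Black \<and> kind x1 = k \<and> kind x2 = k
     \<and> (\<exists>e1 e2. e1 \<noteq> e2 \<and> joins Q e1 y x1 \<and> joins Q e2 y x2)"


section \<open>Koebe polyhedra\<close>

definition circle :: "real^3 \<Rightarrow> real^3 \<Rightarrow> real \<Rightarrow> (real^3) set" where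
  "circle m n \<rho> = {p \<in> sphere m \<rho>. n \<bullet> (p - m) = 0}"

definition spheres_orthogonal :: "real^3 \<Rightarrow> real \<Rightarrow> real^3 \<Rightarrow> real \<Rightarrow> bool" where
  "spheres_orthogonal a r b s \<longleftrightarrow> sphere a r \<inter> sphere b s \<noteq> {}
     \<and> (\<forall>p \<in> sphere a r \<inter> sphere b s. (p - a) \<bullet> (p - b) = 0)"

text \<open>
  The tangent of the circle at \<open>p\<close> has the direction \<open>cross3 n (p - m)\<close>, and the normal of the
  sphere at \<open>p\<close> has the direction \<open>p - a\<close>.
\<close>

definition circle_sphere_orthogonal ::
    "real^3 \<Rightarrow> real^3 \<Rightarrow> real \<Rightarrow> real^3 \<Rightarrow> real \<Rightarrow> bool" where
  "circle_sphere_orthogonal m n \<rho> a s \<longleftrightarrow> circle m n \<rho> \<inter> sphere a s \<noteq> {}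
     \<and> (\<forall>p \<in> circle m n \<rho> \<inter> sphere a s. p - a \<in> span {cross3 n (p - m)})"

definition touch_externally_at ::
    "real^3 \<Rightarrow> real \<Rightarrow> real^3 \<Rightarrow> real \<Rightarrow> real^3 \<Rightarrow> bool" where
  "touch_externally_at a r b s p \<longleftrightarrow> cball a r \<inter> cball b s = {p}"

text \<open>
  \<open>K\<close> gives the points of the black vertices and the centres of the white vertices, \<open>r\<close> the radii
  of the circles and spheres, and \<open>n\<close> the unit normals of the planes of the circles. Two circles
  in the unit sphere touch in a point if this is their only common point.
\<close>

definition koebe_polyhedron ::
    "('v, 'e, 'f) quad_cells \<Rightarrow> ('v \<Rightarrow> vertex_kind)
      \<Rightarrow> ('v \<Rightarrow> real^3) \<Rightarrow> ('v \<Rightarrow> real) \<Rightarrow> ('v \<Rightarrow> real^3) \<Rightarrow> bool" where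
  "koebe_polyhedron Q kind K r n \<longleftrightarrow>
     (\<forall>y\<in>verts Q. kind y = Black \<longrightarrow> K y \<in> sphere 0 1)
   \<and> (\<forall>x\<in>verts Q. kind x = Circ \<longrightarrow>
        r x > 0 \<and> norm (n x) = 1 \<and> circle (K x) (n x) (r x) \<subseteq> sphere 0 1)
   \<and> (\<forall>x\<in>verts Q. kind x = Sph \<longrightarrow> r x > 0 \<and> spheres_orthogonal (K x) (r x) 0 1)
   \<and> (\<forall>e y x. joins Q e y x \<and> kind y = Black \<and> kind x = Circ \<longrightarrow> K y \<in> circle (K x) (n x) (r x))
   \<and> (\<forall>e y x. joins Q e y x \<and> kind y = Black \<and> kind x = Sph \<longrightarrow> K y \<in> sphere (K x) (r x))
   \<and> (\<forall>y x1 x2. neighbour_pair Q kind Sph y x1 x2 \<longrightarrow>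
        touch_externally_at (K x1) (r x1) (K x2) (r x2) (K y))
   \<and> (\<forall>y x1 x2. neighbour_pair Q kind Circ y x1 x2 \<longrightarrow>
        circle (K x1) (n x1) (r x1) \<inter> circle (K x2) (n x2) (r x2) = {K y})
   \<and> (\<forall>f\<in>faces Q. \<forall>i j. kind (corner Q f i) = Circ \<and> kind (corner Q f j) = Sph \<longrightarrow>
        circle_sphere_orthogonal
          (K (corner Q f i)) (n (corner Q f i)) (r (corner Q f i))
          (K (corner Q f j)) (r (corner Q f j)))"


section \<open>S-isothermic minimal surfaces and their associated families\<close>

definition s_isothermic_minimal ::
    "('v, 'e, 'f) quad_cells \<Rightarrow> ('e \<Rightarrow> real) \<Rightarrow> ('v \<Rightarrow> real^3) \<Rightarrow> ('v \<Rightarrow> real^3) \<Rightarrow> bool" where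
  "s_isothermic_minimal Q lab K F0 \<longleftrightarrow>
     (\<forall>e a b. joins Q e a b \<longrightarrow>
        F0 b - F0 a = (lab e / (norm (K b - K a))\<^sup>2) *\<^sub>R (K b - K a))"

text \<open>
  For a unit vector \<open>N\<close> and \<open>v\<close> orthogonal to \<open>N\<close>, this is the rotation of \<open>v\<close> by \<open>\<phi>\<close> in the
  plane orthogonal to \<open>N\<close>, counterclockwise with respect to \<open>N\<close>.
\<close>

definition tangent_rotation :: "real^3 \<Rightarrow> real \<Rightarrow> real^3 \<Rightarrow> real^3" where
  "tangent_rotation N \<phi> v = cos \<phi> *\<^sub>R v + sin \<phi> *\<^sub>R cross3 N v"

text \<open>Only the values of \<open>F \<phi>\<close> at the vertices of kind \<open>Sph\<close> are relevant.\<close>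

definition associated_family ::
    "('v, 'e, 'f) quad_cells \<Rightarrow> ('v \<Rightarrow> vertex_kind) \<Rightarrow> ('e \<Rightarrow> real)
      \<Rightarrow> ('v \<Rightarrow> real^3) \<Rightarrow> ('v \<Rightarrow> real) \<Rightarrow> (real \<Rightarrow> 'v \<Rightarrow> real^3) \<Rightarrow> bool" where
  "associated_family Q kind lab K r F \<longleftrightarrow>
     (\<forall>\<phi> y x1 x2 e. neighbour_pair Q kind Sph y x1 x2 \<and> joins Q e y x1 \<longrightarrow>
        F \<phi> x2 - F \<phi> x1 =
          (lab e / (r x1 * r x2)) *\<^sub>R tangent_rotation (K y) \<phi> (K x2 - K x1))"

definition contact_points ::
    "('v, 'e, 'f) quad_cells \<Rightarrow> ('v \<Rightarrow> vertex_kind)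
      \<Rightarrow> ('v \<Rightarrow> real^3) \<Rightarrow> ('v \<Rightarrow> real) \<Rightarrow> 'v \<Rightarrow> (real^3) set" where
  "contact_points Q kind c R y =
     {p. \<exists>x1 x2. neighbour_pair Q kind Sph y x1 x2
        \<and> p \<in> closed_segment (c x1) (c x2) \<and> p \<in> sphere (c x1) (R x1) \<inter> sphere (c x2) (R x2)}"

end

theory Submission
  imports Defs
begin

text \<open>
  The radii are \<open>R(x) = 1 / r(x)\<close>, and the contact point at \<open>y\<close>, seen from its \<open>s\<close>-labelled neighbour
  \<open>x\<close>, is \<open>F(x) \<plusminus> r(x)\<^sup>-\<^sup>2 \<rho>\<^sub>y(K(y) - K(x))\<close>. In a face \<open>z, y, x, y'\<close> with \<open>z\<close> labelled \<open>c\<close>, the closing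
  condition for \<open>F0\<close> makes \<open>K(y) + K(y')\<close> a combination of \<open>K(x)\<close> and \<open>K(z)\<close>. Hence the difference of the
  contact points at \<open>y\<close> and \<open>y'\<close> is the image of \<open>F0(y') - F0(y)\<close> under the map
  \<open>v \<mapsto> cos \<phi> v + sin \<phi> K(z) \<times> v\<close>, which depends on \<open>z\<close> only. As \<open>K(z)\<close> is normal to the plane of the
  circle at \<open>z\<close>, this map is a similarity of that plane, and it takes the circle of radius \<open>1 / r(z)\<close>
  around \<open>F0(z)\<close> through the points \<open>F0(y)\<close> to the required one. The map vanishes if \<open>K(z) = 0\<close> and
  \<open>cos \<phi> = 0\<close>; then all contact points around \<open>z\<close> coincide.
\<close>

section \<open>Touching spheres\<close>

text \<open>If the centres were closer than \<open>r + s\<close>, the point dividing their segment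
  in the ratio \<open>r : s\<close> would lie strictly inside both balls and so differ from
  \<open>p\<close>. Hence the triangle inequality is an equality at \<open>p\<close>, which puts
  \<open>p\<close> on the segment of centres.\<close>

lemma touching_spheres_collinear:
  fixes a b p :: "'a::euclidean_space"
  assumes touch: "cball a r \<inter> cball b s = {p}"
    and p: "p \<in> sphere a r" "p \<in> sphere b s" and pos: "r > 0" "s > 0"
  obtains v where "norm v = 1" "p = a + r *\<^sub>R v" "b = a + (r + s) *\<^sub>R v"
proof -
  have pa: "dist a p = r" and pb: "dist p b = s"
    using p by (auto simp: dist_commute)
  have "dist a b \<ge> r + s"
  proof (rule ccontr)
    assume less: "\<not> dist a b \<ge> r + s"
    define q where "q = a + (r / (r + s)) *\<^sub>R (b - a)"
    have qa: "dist a q = r / (r + s) * dist a b"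
      using pos by (simp add: q_def dist_norm norm_minus_commute)
    have "q - b = (s / (r + s)) *\<^sub>R (a - b)"
    proof -
      have "s / (r + s) = 1 - r / (r + s)" using pos by (simp add: field_simps)
      then show ?thesis by (simp add: q_def scaleR_diff_left scaleR_diff_right)
    qed
    then have qb: "dist b q = s / (r + s) * dist a b"
      using pos unfolding dist_norm norm_minus_commute[of b q] by simp
    have "dist a q < r / (r + s) * (r + s)" "dist b q < s / (r + s) * (r + s)"
      unfolding qa qb by (rule mult_strict_left_mono; use less pos in simp)+
    then have "dist a q < r" "dist b q < s" using pos by simp_all
    then show False using touch pa by auto
  qed
  then have "dist a b = dist a p + dist p b"
    using dist_triangle[of a b p] pa pb by simp
  then have eq: "r *\<^sub>R (p - b) = s *\<^sub>R (a - p)"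
    using pa pb unfolding dist_triangle_eq by (simp add: dist_norm)
  define v where "v = (1 / r) *\<^sub>R (p - a)"
  show ?thesis
  proof
    show "norm v = 1" using pa pos by (simp add: v_def dist_norm norm_minus_commute)
    show pv: "p = a + r *\<^sub>R v" using pos by (simp add: v_def)
    have "r *\<^sub>R (p + s *\<^sub>R v) = r *\<^sub>R b"
      using eq pos by (simp add: v_def algebra_simps)
    then have "b = p + s *\<^sub>R v" using pos by simp
    then show "b = a + (r + s) *\<^sub>R v" using pv by (simp add: algebra_simps)
  qed
qed

text \<open>A common point of the balls forces equality in the triangle inequality for the centres,
  and this equality determines the point.\<close>

lemma touch_externally_atI:
  assumes v: "norm v = 1" and pos: "r > 0" "s > 0"
  shows "touch_externally_at a r (a + (r + s) *\<^sub>R v) s (a + r *\<^sub>R v)"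
proof -
  let ?b = "a + (r + s) *\<^sub>R v"
  have eq: "q = a + r *\<^sub>R v" if q: "dist a q \<le> r" "dist ?b q \<le> s" for q
  proof -
    have "dist a ?b = r + s" using v pos by (simp add: dist_norm)
    then have qr: "dist a q = r" and qs: "dist q ?b = s"
      using q dist_triangle[of a ?b q] by (auto simp: dist_commute)
    then have "r *\<^sub>R (q - ?b) = s *\<^sub>R (a - q)"
      using dist_triangle_eq[of a ?b q] \<open>dist a ?b = r + s\<close> by (simp add: dist_norm)
    then have "(r + s) *\<^sub>R q = (r + s) *\<^sub>R (a + r *\<^sub>R v)"
      by (simp add: algebra_simps)
    then show ?thesis using pos by (metis add_pos_pos less_irrefl scaleR_cancel_left)
  qed
  have "?b - (a + r *\<^sub>R v) = s *\<^sub>R v" by (simp add: algebra_simps)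
  then have "dist a (a + r *\<^sub>R v) \<le> r" "dist ?b (a + r *\<^sub>R v) \<le> s"
    using v pos unfolding dist_norm by simp_all
  then have "a + r *\<^sub>R v \<in> cball a r \<inter> cball ?b s" by (simp only: Int_iff mem_cball)
  moreover have "cball a r \<inter> cball ?b s \<subseteq> {a + r *\<^sub>R v}"
    using eq by (simp only: subset_iff Int_iff mem_cball singleton_iff) blast
  ultimately show ?thesis unfolding touch_externally_at_def by blast
qed

text \<open>On the segment the distance from \<open>a\<close> already determines the point. This
  turns the set \<open>contact_points\<close> into an explicit vector.\<close>

lemma segment_contact_point:
  fixes a v :: "'a::real_normed_vector"
  assumes v: "norm v = 1" and pos: "r > 0" "s > 0"
  defines "b \<equiv> a + (r + s) *\<^sub>R v"
  shows "closed_segment a b \<inter> (sphere a r \<inter> sphere b s) = {a + r *\<^sub>R v}"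
proof -
  have eq: "p = a + r *\<^sub>R v" if p: "p \<in> closed_segment a b" "dist a p = r" for p
  proof -
    obtain t where t: "0 \<le> t" "p = (1 - t) *\<^sub>R a + t *\<^sub>R b"
      using p(1) by (auto simp: closed_segment_def)
    then have pt: "p = a + (t * (r + s)) *\<^sub>R v" by (simp add: b_def algebra_simps)
    then have "t * (r + s) = r" using p(2) v t(1) pos by (simp add: dist_norm)
    then show ?thesis using pt by simp
  qed
  have "a + r *\<^sub>R v = (1 - r / (r + s)) *\<^sub>R a + (r / (r + s)) *\<^sub>R b"
  proof -
    have "r / (r + s) * (r + s) = r" using pos by simp
    then have "(r / (r + s)) *\<^sub>R b = (r / (r + s)) *\<^sub>R a + r *\<^sub>R v"
      unfolding b_def scaleR_add_right scaleR_scaleR by simp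
    then show ?thesis by (simp add: algebra_simps)
  qed
  then have "a + r *\<^sub>R v \<in> closed_segment a b"
    using pos unfolding closed_segment_def
    by (intro CollectI exI[of _ "r / (r + s)"]) (auto simp: field_simps)
  moreover have "b - (a + r *\<^sub>R v) = s *\<^sub>R v" by (simp add: b_def algebra_simps)
  then have "dist a (a + r *\<^sub>R v) = r" "dist b (a + r *\<^sub>R v) = s"
    using v pos unfolding dist_norm by simp_all
  then have "a + r *\<^sub>R v \<in> sphere a r \<inter> sphere b s" by (simp only: Int_iff mem_sphere)
  ultimately have "a + r *\<^sub>R v \<in> closed_segment a b \<inter> (sphere a r \<inter> sphere b s)" by blast
  moreover have "closed_segment a b \<inter> (sphere a r \<inter> sphere b s) \<subseteq> {a + r *\<^sub>R v}"
    using eq by (simp only: subset_iff Int_iff mem_sphere singleton_iff) blast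
  ultimately show ?thesis by blast
qed

section \<open>Circles and rotations\<close>

lemma tangent_rotation_scaleR:
  "tangent_rotation N \<phi> (c *\<^sub>R v) = c *\<^sub>R tangent_rotation N \<phi> v"
  by (simp add: tangent_rotation_def cross_mult_right algebra_simps)

lemma tangent_rotation_diff:
  "tangent_rotation N \<phi> (v - w) = tangent_rotation N \<phi> v - tangent_rotation N \<phi> w"
  by (simp add: tangent_rotation_def Cross3.right_diff_distrib algebra_simps)

text \<open>\<open>v\<close> and \<open>cross3 N v\<close> are orthogonal, so Pythagoras applies.
  The length of \<open>N\<close> is left free: a unit \<open>N\<close> gives the factor 1, while
  \<open>N = K z\<close> at a circle vertex \<open>z\<close> gives the squared ratio by which the
  plane of the circle is scaled.\<close>

lemma norm_tangent_rotation:
  assumes "N \<bullet> v = 0"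
  shows "(norm (tangent_rotation N \<phi> v))\<^sup>2 = ((cos \<phi>)\<^sup>2 + (sin \<phi>)\<^sup>2 * (norm N)\<^sup>2) * (norm v)\<^sup>2"
proof -
  have "(norm (cross3 N v))\<^sup>2 = (norm N)\<^sup>2 * (norm v)\<^sup>2"
    using assms by (simp add: norm_cross)
  moreover have "v \<bullet> cross3 N v = 0" by (simp add: dot_cross_self)
  ultimately show ?thesis
    unfolding tangent_rotation_def power2_norm_eq_inner
    by (simp add: inner_add_left inner_add_right inner_commute power2_eq_square algebra_simps)
qed

text \<open>The opposite points \<open>m + u\<close> and \<open>m - u\<close> of the circle have
  equal norm, so \<open>m\<close> is orthogonal to its own component \<open>w\<close> in the plane
  of the circle; this forces \<open>w = 0\<close>.\<close>

lemma circle_in_unit_sphere_center: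
  assumes n: "norm n = 1" and "\<rho> > 0" and sub: "circle m n \<rho> \<subseteq> sphere 0 1"
  shows "m = (n \<bullet> m) *\<^sub>R n"
proof (rule ccontr)
  assume ne: "m \<noteq> (n \<bullet> m) *\<^sub>R n"
  define w where "w = m - (n \<bullet> m) *\<^sub>R n"
  define u where "u = (\<rho> / norm w) *\<^sub>R w"
  have w: "norm w > 0" using ne by (simp add: w_def)
  have nn: "n \<bullet> n = 1" using n by (simp add: dot_square_norm)
  have nw: "n \<bullet> w = 0" by (simp add: w_def inner_diff_right nn)
  then have "m + u \<in> circle m n \<rho>" "m - u \<in> circle m n \<rho>"
    using w \<open>\<rho> > 0\<close> by (auto simp: circle_def u_def dist_norm)
  then have "m + u \<in> sphere 0 1" "m - u \<in> sphere 0 1" using sub by blast+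
  then have "norm (m + u) = norm (m - u)" by simp
  then have "m \<bullet> u = 0" by (simp add: norm_eq inner_add_left inner_add_right inner_diff_left inner_diff_right inner_commute)
  then have "m \<bullet> w = 0" using w \<open>\<rho> > 0\<close> by (simp add: u_def)
  moreover have "m \<bullet> w = w \<bullet> w + (n \<bullet> m) * (n \<bullet> w)"
    by (simp add: w_def algebra_simps inner_commute)
  ultimately show False using nw w by simp
qed

text \<open>Serves the degenerate case in which all contact points around a circle vertex coincide
  while a circle of positive radius is still required.\<close>

lemma ex_circle_through_point:
  fixes n q :: "real^3"
  obtains m \<rho> where "\<rho> > 0" "q \<in> circle m n \<rho>"
proof -
  obtain u :: "real^3" where u: "u \<noteq> 0" "orthogonal n u"
    using orthogonal_to_vector_exists[of n] by auto
  have "q \<in> circle (q - u) n (norm u)"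
    using u by (simp add: circle_def dist_norm orthogonal_def)
  then show ?thesis using that[of "norm u"] u by simp
qed

section \<open>Combinatorics of S-quad-graphs\<close>

lemma glued_sym: "glued Q s t \<Longrightarrow> glued Q t s"
  by (auto simp: glued_def)

lemma glued_unique: "quad_graph Q \<Longrightarrow> glued Q s t \<Longrightarrow> glued Q s u \<Longrightarrow> t = u"
  unfolding quad_graph_def by blast

lemma corner_eq_iff:
  assumes "quad_graph Q" "f \<in> faces Q" "g \<in> faces Q"
  shows "corner Q f i = corner Q g j \<longleftrightarrow> equivclp (corner_glued Q) (f, i) (g, j)"
  using assms unfolding quad_graph_def by blast

lemma glued_corners:
  assumes "quad_graph Q" "glued Q (f, i) (g, j)"
  shows "corner Q f i = corner Q g (j + 1)"
proof -
  have "corner_glued Q (f, i) (g, j + 1)" using assms by (simp add: corner_glued_def)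
  moreover have "f \<in> faces Q" "g \<in> faces Q" using assms(2) by (auto simp: glued_def)
  ultimately show ?thesis
    using corner_eq_iff[OF assms(1)] by (simp add: r_into_equivclp)
qed

lemma joins_side: "f \<in> faces Q \<Longrightarrow> joins Q (side Q f i) (corner Q f i) (corner Q f (i + 1))"
  unfolding joins_def by blast

lemma joins_commute: "joins Q e a b \<longleftrightarrow> joins Q e b a"
  unfolding joins_def by (simp add: insert_commute)

text \<open>Distinct sides that carry the same edge are glued, and gluing identifies their end
  corners crosswise.\<close>

lemma joins_ends:
  assumes "quad_graph Q" "joins Q e a b" "joins Q e c d"
  shows "{a, b} = {c, d}"
proof -
  obtain f i where f: "f \<in> faces Q" "side Q f i = e" "{corner Q f i, corner Q f (i + 1)} = {a, b}"
    using assms(2) unfolding joins_def by blast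
  obtain g j where g: "g \<in> faces Q" "side Q g j = e" "{corner Q g j, corner Q g (j + 1)} = {c, d}"
    using assms(3) unfolding joins_def by blast
  show ?thesis
  proof (cases "(f, i) = (g, j)")
    case True
    then show ?thesis using f g by auto
  next
    case False
    then have gl: "glued Q (f, i) (g, j)" using f g by (simp add: glued_def)
    show ?thesis
      using glued_corners[OF assms(1) gl] glued_corners[OF assms(1) glued_sym[OF gl]] f g by auto
  qed
qed

lemma joins_vertsD: "joins Q e a b \<Longrightarrow> a \<in> verts Q \<and> b \<in> verts Q"
  unfolding joins_def verts_def by (auto simp: doubleton_eq_iff)

lemma joins_edgesD: "joins Q e a b \<Longrightarrow> e \<in> edges Q"
  unfolding joins_def edges_def by auto

lemma neighbour_pair_commute:
  "neighbour_pair Q kind k y x1 x2 \<longleftrightarrow> neighbour_pair Q kind k y x2 x1"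
  unfolding neighbour_pair_def by metis

text \<open>Colours alternate around the face and it has only one \<open>Circ\<close> corner, so the
  opposite white corner can only be \<open>Sph\<close>.\<close>

lemma face_kinds:
  assumes "S_quad_graph Q kind" "f \<in> faces Q" "kind (corner Q f i) = Circ"
  shows "kind (corner Q f (i + 1)) = Black" "kind (corner Q f (i + 2)) = Sph"
    "kind (corner Q f (i - 1)) = Black"
proof -
  have alt: "kind (corner Q f k) = Black \<longleftrightarrow> kind (corner Q f (k + 1)) \<noteq> Black" for k
    using assms joins_side[OF assms(2), of k] unfolding S_quad_graph_def by blast
  show "kind (corner Q f (i + 1)) = Black" using alt[of i] assms(3) by auto
  then have "kind (corner Q f (i + 2)) \<noteq> Black" using alt[of "i + 1"] by (simp add: add.assoc)
  moreover have "i + 2 \<noteq> i" by simp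
  then have "kind (corner Q f (i + 2)) \<noteq> Circ"
    using assms unfolding S_quad_graph_def by metis
  ultimately show "kind (corner Q f (i + 2)) = Sph" by (cases "kind (corner Q f (i + 2))") auto
  show "kind (corner Q f (i - 1)) = Black" using alt[of "i - 1"] assms(3) by auto
qed

text \<open>If the two edges coincided, the two faces would close up around \<open>y\<close>, which would be an
  interior black vertex of degree at most 2.\<close>

lemma neighbour_pair_of_glued_faces:
  assumes S: "S_quad_graph Q kind" and gl: "glued Q (f, i) (g, j)"
    and z: "kind (corner Q f i) = Circ"
  shows "neighbour_pair Q kind Sph (corner Q f (i + 1)) (corner Q f (i + 2)) (corner Q g (j - 1))"
proof -
  define y where "y = corner Q f (i + 1)"
  have Q: "quad_graph Q" using S by (simp add: S_quad_graph_def)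
  have F: "f \<in> faces Q" "g \<in> faces Q" using gl by (auto simp: glued_def)
  have zg: "corner Q f i = corner Q g (j + 1)" and yg: "y = corner Q g j"
    using glued_corners[OF Q gl] glued_corners[OF Q glued_sym[OF gl]] by (simp_all add: y_def)
  have j3: "j + 3 = j - 1" by (simp add: algebra_simps)
  have "kind (corner Q g (j + 3)) = Sph"
    using face_kinds(2)[OF S F(2), of "j + 1"] z zg by (simp add: add.assoc)
  then have kinds: "kind y = Black" "kind (corner Q f (i + 2)) = Sph" "kind (corner Q g (j - 1)) = Sph"
    using face_kinds[OF S F(1) z] unfolding j3 y_def by simp_all
  have "side Q f (i + 1) \<noteq> side Q g (j - 1)"
  proof
    assume eq: "side Q f (i + 1) = side Q g (j - 1)"
    \<comment> \<open>If the two sides were the same side of one face, \<open>y\<close> would be its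
      corner \<open>i + 2\<close>, which is labelled \<open>Sph\<close>.\<close>
    have "(f, i + 1) \<noteq> (g, j - 1)"
    proof
      assume "(f, i + 1) = (g, j - 1)"
      then have "f = g" "j = i + 2" by (auto simp: algebra_simps)
      then show False using kinds yg by simp
    qed
    then have gl': "glued Q (f, i + 1) (g, j - 1)" using eq F by (simp add: glued_def)
    \<comment> \<open>These are all the corners at \<open>y\<close>: both gluings lead from one of
      them to the other, and a side is glued to at most one side, so no third corner is identified
      with them.\<close>
    let ?C = "{(f, i + 1), (g, j)}"
    have stable: "c \<in> ?C \<longleftrightarrow> d \<in> ?C" if "corner_glued Q c d" for c d
    proof -
      obtain h k where d: "d = (h, k)" by (cases d)
      have cd: "glued Q c (h, k - 1)" using that d by (simp add: corner_glued_def)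
      have 1: "c = (f, i + 1) \<Longrightarrow> d = (g, j)"
        using glued_unique[OF Q cd, of "(g, j - 1)"] gl' d by auto
      have 2: "c = (g, j) \<Longrightarrow> d = (f, i + 1)"
        using glued_unique[OF Q cd, of "(f, i)"] glued_sym[OF gl] d by (auto simp: algebra_simps)
      have 3: "d = (f, i + 1) \<Longrightarrow> c = (g, j)"
        using glued_unique[OF Q glued_sym[OF cd], of "(g, j)"] gl d by auto
      have 4: "d = (g, j) \<Longrightarrow> c = (f, i + 1)"
        using glued_unique[OF Q glued_sym[OF cd], of "(f, i + 1)"] glued_sym[OF gl'] d by auto
      show ?thesis using 1 2 3 4 by blast
    qed
    have closed: "c \<in> ?C \<longleftrightarrow> d \<in> ?C" if "equivclp (corner_glued Q) c d" for c d
      using that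
    proof (induction rule: equivclp_induct)
      case (step d e)
      then show ?case using stable[of d e] stable[of e d] by argo
    qed simp
    have corners: "(h, k) \<in> ?C" if "h \<in> faces Q" "corner Q h k = y" for h k
    proof -
      have "equivclp (corner_glued Q) (f, i + 1) (h, k)"
        using corner_eq_iff[OF Q F(1) that(1), of "i + 1" k] that(2) by (simp add: y_def)
      from closed[OF this] show ?thesis by simp
    qed
    have "interior_vertex Q y"
      unfolding interior_vertex_def
    proof (intro conjI ballI allI impI)
      show "y \<in> verts Q" using F unfolding verts_def y_def by blast
      fix h k assume "h \<in> faces Q" "corner Q h k = y"
      then have "(h, k) \<in> ?C" by (rule corners)
      then show "\<exists>s. glued Q (h, k) s" "\<exists>s. glued Q (h, k - 1) s"
        using gl gl' glued_sym[OF gl] glued_sym[OF gl'] by (auto; blast)+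
    qed
    then have "degree Q y = 4" using S kinds(1) unfolding S_quad_graph_def by blast
    \<comment> \<open>Every edge at \<open>y\<close> is a side that begins or ends at one of the two
      corners; the two gluings leave only two edges among these four sides.\<close>
    moreover have "{e. \<exists>w. joins Q e y w} \<subseteq> {side Q f i, side Q f (i + 1)}"
    proof
      fix e assume "e \<in> {e. \<exists>w. joins Q e y w}"
      then obtain h k where h: "h \<in> faces Q" "side Q h k = e" "corner Q h k = y \<or> corner Q h (k + 1) = y"
        unfolding joins_def by (auto simp: doubleton_eq_iff)
      then have "(h, k) \<in> ?C \<or> (h, k + 1) \<in> ?C" using corners by blast
      moreover have "k = j - 1" if "k + 1 = j" using that by auto
      ultimately have "(h, k) \<in> {(f, i + 1), (g, j), (f, i), (g, j - 1)}" by auto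
      then show "e \<in> {side Q f i, side Q f (i + 1)}" using h(2) gl eq by (auto simp: glued_def)
    qed
    then have "degree Q y \<le> card {side Q f i, side Q f (i + 1)}"
      unfolding degree_def by (intro card_mono) auto
    moreover have "card {side Q f i, side Q f (i + 1)} \<le> 2" by (simp add: card_insert_if)
    ultimately show False by simp
  qed
  moreover have "joins Q (side Q f (i + 1)) y (corner Q f (i + 2))"
    using joins_side[OF F(1), of "i + 1"] by (simp add: y_def add.assoc)
  moreover have "joins Q (side Q g (j - 1)) y (corner Q g (j - 1))"
    using joins_side[OF F(2), of "j - 1"] yg by (simp add: joins_commute)
  ultimately show ?thesis using kinds unfolding neighbour_pair_def y_def by blast
qed

section \<open>The associated family\<close>

text \<open>With \<open>c = 1 / r(x)\<^sup>2\<close> and \<open>d = 1 / r(z)\<^sup>2\<close> the hypothesis says that the dual of the kite with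
  vertices \<open>z, y, x, y'\<close> closes up; then \<open>y + y'\<close> is parallel to \<open>c x + d z\<close>.\<close>

lemma rotated_kite:
  fixes x y y' z :: "real^3"
  assumes pos: "c > 0" "d > 0"
    and closing: "d *\<^sub>R ((y - z) + (y' - z)) + c *\<^sub>R ((y - x) + (y' - x)) = 0"
  shows "c *\<^sub>R (tangent_rotation y' \<phi> (y' - x) + tangent_rotation y \<phi> (y - x))
    = - d *\<^sub>R tangent_rotation z \<phi> ((y - z) + (y' - z))"
proof -
  define S where "S = y + y'"
  have "(c + d) *\<^sub>R S = 2 *\<^sub>R (c *\<^sub>R x + d *\<^sub>R z)"
    using closing by (simp add: vec_eq_iff S_def) (simp add: algebra_simps)
  \<comment> \<open>Crossing with \<open>S\<close> kills the left-hand side and trades the axis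
    \<open>x\<close> for the axis \<open>z\<close>.\<close>
  then have "cross3 ((c + d) *\<^sub>R S) S = cross3 (2 *\<^sub>R (c *\<^sub>R x + d *\<^sub>R z)) S" by simp
  then have "2 *\<^sub>R (c *\<^sub>R cross3 x S + d *\<^sub>R cross3 z S) = 0"
    by (simp only: cross_mult_left cross_add_left cross_refl scaleR_zero_right)
  then have sin_part: "c *\<^sub>R cross3 x S = - d *\<^sub>R cross3 z S"
    by (simp add: eq_neg_iff_add_eq_0)
  have cos_part: "c *\<^sub>R ((y - x) + (y' - x)) = - d *\<^sub>R ((y - z) + (y' - z))"
    using closing by (simp add: eq_neg_iff_add_eq_0 add.commute)
  \<comment> \<open>Since \<open>cross3 y y = 0\<close>, the sine parts of the rotations about the
    two axes \<open>y\<close> and \<open>y'\<close> merge into one product with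
    \<open>x\<close>.\<close>
  have "cross3 y' (y' - x) + cross3 y (y - x) = cross3 x S"
    by (simp add: S_def Cross3.right_diff_distrib cross_add_right cross_skew[of _ x])
  moreover have "tangent_rotation y' \<phi> (y' - x) + tangent_rotation y \<phi> (y - x)
      = cos \<phi> *\<^sub>R ((y - x) + (y' - x)) + sin \<phi> *\<^sub>R (cross3 y' (y' - x) + cross3 y (y - x))"
    by (simp only: tangent_rotation_def scaleR_add_right add_ac)
  ultimately have "c *\<^sub>R (tangent_rotation y' \<phi> (y' - x) + tangent_rotation y \<phi> (y - x))
      = cos \<phi> *\<^sub>R (c *\<^sub>R ((y - x) + (y' - x))) + sin \<phi> *\<^sub>R (c *\<^sub>R cross3 x S)"
    by (simp only: scaleR_add_right scaleR_left_commute)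
  also have "\<dots> = - d *\<^sub>R (cos \<phi> *\<^sub>R ((y - z) + (y' - z)) + sin \<phi> *\<^sub>R cross3 z S)"
    unfolding sin_part cos_part by (simp only: scaleR_add_right scaleR_left_commute)
  also have "cross3 z S = cross3 z ((y - z) + (y' - z))"
    by (simp only: S_def Cross3.right_diff_distrib cross_add_right cross_refl diff_zero)
  finally show ?thesis by (simp only: tangent_rotation_def)
qed

locale koebe_associated_family =
  fixes Q :: "('v, 'e, 'f) quad_cells" and kind :: "'v \<Rightarrow> vertex_kind" and lab :: "'e \<Rightarrow> real"
    and K :: "'v \<Rightarrow> real^3" and r :: "'v \<Rightarrow> real" and n :: "'v \<Rightarrow> real^3"
    and F0 :: "'v \<Rightarrow> real^3" and F :: "real \<Rightarrow> 'v \<Rightarrow> real^3"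
  assumes S: "S_quad_graph Q kind" and labelling: "edge_labelling Q lab"
    and koebe: "koebe_polyhedron Q kind K r n"
    and dual: "s_isothermic_minimal Q lab K F0"
    and family: "associated_family Q kind lab K r F"
begin

section \<open>Tangency and collinearity along the edges of the Koebe polyhedron\<close>

lemma quad: "quad_graph Q"
  using S by (simp add: S_quad_graph_def)

lemma abs_lab: "joins Q e a b \<Longrightarrow> \<bar>lab e\<bar> = 1"
  using labelling joins_edgesD unfolding edge_labelling_def by fastforce

lemma lab_side_add_one:
  assumes "f \<in> faces Q"
  shows "lab (side Q f (i + 1)) = - lab (side Q f i)"
proof -
  have "lab (side Q f i) \<noteq> lab (side Q f (i + 1))"
    using labelling assms unfolding edge_labelling_def by blast
  then show ?thesis
    using abs_lab[OF joins_side[OF assms, of i]] abs_lab[OF joins_side[OF assms, of "i + 1"]]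
    by argo
qed

lemma sph_radius_pos: "joins Q e y x \<Longrightarrow> kind x = Sph \<Longrightarrow> r x > 0"
  using koebe joins_vertsD[of Q e y x] unfolding koebe_polyhedron_def by blast

text \<open>Radii of orthogonal spheres are perpendicular at a common point. So the edge through
  \<open>K y\<close> is tangent to the unit sphere there, and \<open>tangent_rotation (K y)\<close>
  acts on it as a genuine rotation.\<close>

lemma sph_edge:
  assumes e: "joins Q e y x" and "kind y = Black" "kind x = Sph"
  shows "norm (K y) = 1" "K y \<in> sphere (K x) (r x)" "K y \<bullet> (K y - K x) = 0"
proof -
  have "K y \<in> sphere 0 1" and x: "K y \<in> sphere (K x) (r x)"
    and orth: "spheres_orthogonal (K x) (r x) 0 1"
    using koebe assms joins_vertsD[OF e] unfolding koebe_polyhedron_def by blast+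
  then show "norm (K y) = 1" by simp
  show "K y \<in> sphere (K x) (r x)" by (rule x)
  show "K y \<bullet> (K y - K x) = 0"
    using orth x \<open>K y \<in> sphere 0 1\<close> unfolding spheres_orthogonal_def
    by (metis IntI diff_zero inner_commute)
qed

lemma circ_edge:
  assumes e: "joins Q e z y" and "kind y = Black" "kind z = Circ"
  shows "norm (K y - K z) = r z" "n z \<bullet> (K y - K z) = 0"
proof -
  have "K y \<in> circle (K z) (n z) (r z)"
    using koebe assms unfolding koebe_polyhedron_def joins_commute[of Q e z y] by blast
  then show "norm (K y - K z) = r z" "n z \<bullet> (K y - K z) = 0"
    by (auto simp: circle_def dist_norm norm_minus_commute)
qed

lemma pair_collinear:
  assumes p: "neighbour_pair Q kind Sph y x1 x2"
  obtains v where "norm v = 1" "K y = K x1 + r x1 *\<^sub>R v" "K x2 = K x1 + (r x1 + r x2) *\<^sub>R v"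
    "r x1 > 0" "r x2 > 0"
proof -
  obtain e1 e2 where e: "joins Q e1 y x1" "joins Q e2 y x2"
    and k: "kind y = Black" "kind x1 = Sph" "kind x2 = Sph"
    using p unfolding neighbour_pair_def by blast
  have "cball (K x1) (r x1) \<inter> cball (K x2) (r x2) = {K y}"
    using koebe p unfolding koebe_polyhedron_def touch_externally_at_def by blast
  from touching_spheres_collinear[OF this sph_edge(2)[OF e(1)] sph_edge(2)[OF e(2)]]
  show ?thesis using that sph_radius_pos e k by metis
qed

lemma pair_distinct: "neighbour_pair Q kind Sph y x1 x2 \<Longrightarrow> x1 \<noteq> x2"
  by (erule pair_collinear) auto

text \<open>Three spheres cannot pairwise touch externally at one point, so a black vertex has at most
  two \<open>s\<close>-labelled neighbours, even on the boundary.\<close>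

lemma pair_unique:
  assumes p: "neighbour_pair Q kind Sph y x1 x2" and q: "neighbour_pair Q kind Sph y a b"
  shows "{a, b} = {x1, x2}"
proof -
  have third: "c = x1 \<or> c = x2" if c: "joins Q e y c" "kind c = Sph" for e c
  proof (rule ccontr)
    assume ne: "\<not> (c = x1 \<or> c = x2)"
    have y: "kind y = Black" using p by (simp add: neighbour_pair_def)
    have pair: "neighbour_pair Q kind Sph y x c" if "joins Q e' y x" "kind x = Sph" "c \<noteq> x" for e' x
    proof -
      have "y \<noteq> c" using y c by auto
      \<comment> \<open>An edge determines its ends, so edges to different neighbours of
        \<open>y\<close> differ.\<close>
      then have "e' \<noteq> e" using joins_ends[OF quad c(1), of y x] that by (auto simp: doubleton_eq_iff)
      then show ?thesis using that c y unfolding neighbour_pair_def by blast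
    qed
    have "neighbour_pair Q kind Sph y x1 c" "neighbour_pair Q kind Sph y x2 c"
      using p pair ne unfolding neighbour_pair_def by blast+
    then obtain v1 v2 where
      1: "norm v1 = 1" "K y = K x1 + r x1 *\<^sub>R v1" "K c = K x1 + (r x1 + r c) *\<^sub>R v1" "r c > 0"
      and 2: "K y = K x2 + r x2 *\<^sub>R v2" "K c = K x2 + (r x2 + r c) *\<^sub>R v2"
      by (metis pair_collinear)
    obtain v where
      3: "K y = K x1 + r x1 *\<^sub>R v" "K x2 = K x1 + (r x1 + r x2) *\<^sub>R v" "r x1 > 0" "r x2 > 0"
      using pair_collinear[OF p] by metis
    \<comment> \<open>\<open>v1\<close> and \<open>v2\<close> point from \<open>K x1\<close> and
      \<open>K x2\<close> to \<open>K y\<close>, hence are opposite because these two spheres touch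
      there. Both also point from \<open>K y\<close> to \<open>K c\<close>, hence are equal.\<close>
    have "v = v1" using 1(2) 3 by simp
    moreover have "r x2 *\<^sub>R v2 = r x2 *\<^sub>R (- v)" using 2(1) 3(1,2) by (simp add: algebra_simps eq_neg_iff_add_eq_0)
    then have "v2 = - v" using 3(4) by (simp only: scaleR_cancel_left) simp
    moreover have "K c = K y + r c *\<^sub>R v1" unfolding 1(2,3) by (simp add: scaleR_add_left)
    moreover have "K c = K y + r c *\<^sub>R v2" unfolding 2 by (simp add: scaleR_add_left)
    ultimately have "v2 = - v1" "r c *\<^sub>R v1 = r c *\<^sub>R v2" by simp_all
    moreover from this have "v1 = v2" using 1(4) by simp
    ultimately have "2 *\<^sub>R v1 = 0" unfolding scaleR_2 by (metis add.right_inverse)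
    then have "v1 = 0" by simp
    then show False using 1(1) by simp
  qed
  have "a \<in> {x1, x2}" "b \<in> {x1, x2}" using q third unfolding neighbour_pair_def by blast+
  then show ?thesis using pair_distinct[OF q] by auto
qed

section \<open>Spheres and contact points of the associated family\<close>

text \<open>The rotation keeps the length \<open>r x1 + r x2\<close>, and division by
  \<open>r x1 * r x2\<close> makes it the sum of the inverse radii. The third equation expresses the
  step from \<open>F \<phi> x1\<close> to the contact point without reference to
  \<open>x2\<close>.\<close>

lemma family_collinear:
  assumes p: "neighbour_pair Q kind Sph y x1 x2" and e: "joins Q e y x1"
  obtains u where "norm u = 1" "F \<phi> x2 = F \<phi> x1 + (1 / r x1 + 1 / r x2) *\<^sub>R u"
    "(1 / r x1) *\<^sub>R u = (lab e / (r x1)\<^sup>2) *\<^sub>R tangent_rotation (K y) \<phi> (K y - K x1)"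
    "r x1 > 0" "r x2 > 0"
proof -
  obtain v where v: "norm v = 1" "K y = K x1 + r x1 *\<^sub>R v" "K x2 = K x1 + (r x1 + r x2) *\<^sub>R v"
    and pos: "r x1 > 0" "r x2 > 0"
    by (rule pair_collinear[OF p])
  have yv: "K y - K x1 = r x1 *\<^sub>R v" and xv: "K x2 - K x1 = (r x1 + r x2) *\<^sub>R v"
    using v by (metis add_diff_cancel_left')+
  have k: "kind y = Black" "kind x1 = Sph" using p by (auto simp: neighbour_pair_def)
  have "K y \<bullet> v = 0" using sph_edge(3)[OF e k] yv pos by simp
  from norm_tangent_rotation[OF this, of \<phi>]
  have "(norm (tangent_rotation (K y) \<phi> v))\<^sup>2 = 1" using sph_edge(1)[OF e k] v(1) by simp
  then have rot: "norm (tangent_rotation (K y) \<phi> v) = 1"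
    by (metis norm_ge_zero one_power2 power2_eq_iff_nonneg zero_le_one)
  let ?u = "lab e *\<^sub>R tangent_rotation (K y) \<phi> v"
  show ?thesis
  proof
    show "norm ?u = 1" using rot abs_lab[OF e] by simp
    have "F \<phi> x2 - F \<phi> x1 = (lab e / (r x1 * r x2)) *\<^sub>R tangent_rotation (K y) \<phi> (K x2 - K x1)"
      using family p e unfolding associated_family_def by blast
    also have "\<dots> = ((r x1 + r x2) / (r x1 * r x2)) *\<^sub>R ?u"
      by (simp add: xv tangent_rotation_scaleR mult.commute)
    also have "(r x1 + r x2) / (r x1 * r x2) = 1 / r x1 + 1 / r x2"
      using pos by (simp add: field_simps)
    finally show "F \<phi> x2 = F \<phi> x1 + (1 / r x1 + 1 / r x2) *\<^sub>R ?u"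
      by (simp add: algebra_simps)
    show "(1 / r x1) *\<^sub>R ?u = (lab e / (r x1)\<^sup>2) *\<^sub>R tangent_rotation (K y) \<phi> (K y - K x1)"
      using pos by (simp add: yv tangent_rotation_scaleR power2_eq_square)
  qed (use pos in auto)
qed

lemma family_touches:
  assumes p: "neighbour_pair Q kind Sph y x1 x2"
  shows "\<exists>p. touch_externally_at (F \<phi> x1) (1 / r x1) (F \<phi> x2) (1 / r x2) p"
proof -
  obtain e where e: "joins Q e y x1" using p unfolding neighbour_pair_def by blast
  obtain u where "norm u = 1" "F \<phi> x2 = F \<phi> x1 + (1 / r x1 + 1 / r x2) *\<^sub>R u" "r x1 > 0" "r x2 > 0"
    by (rule family_collinear[OF p e, of \<phi>])
  then show ?thesis using touch_externally_atI[of u "1 / r x1" "1 / r x2" "F \<phi> x1"] by auto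
qed

abbreviation contacts :: "real \<Rightarrow> 'v \<Rightarrow> (real^3) set" where
  "contacts \<phi> \<equiv> contact_points Q kind (F \<phi>) (\<lambda>x. 1 / r x)"

text \<open>By \<open>pair_unique\<close> only this pair, in either order, contributes to the set,
  and the order does not affect the intersection.\<close>

lemma contacts_of_pair:
  assumes p: "neighbour_pair Q kind Sph y x1 x2" and e: "joins Q e y x1"
  shows "contacts \<phi> y
    = {F \<phi> x1 + (lab e / (r x1)\<^sup>2) *\<^sub>R tangent_rotation (K y) \<phi> (K y - K x1)}"
proof -
  let ?T = "\<lambda>a b. closed_segment (F \<phi> a) (F \<phi> b) \<inter> (sphere (F \<phi> a) (1 / r a) \<inter> sphere (F \<phi> b) (1 / r b))"
  have comm: "?T a b = ?T b a" for a b by (metis closed_segment_commute Int_commute)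
  have "?T a b = ?T x1 x2" if "neighbour_pair Q kind Sph y a b" for a b
    using pair_unique[OF p that] comm by (auto simp: doubleton_eq_iff)
  then have "contacts \<phi> y = ?T x1 x2" using p unfolding contact_points_def by blast
  moreover obtain u where u: "norm u = 1" "F \<phi> x2 = F \<phi> x1 + (1 / r x1 + 1 / r x2) *\<^sub>R u"
    "(1 / r x1) *\<^sub>R u = (lab e / (r x1)\<^sup>2) *\<^sub>R tangent_rotation (K y) \<phi> (K y - K x1)"
    "r x1 > 0" "r x2 > 0"
    by (rule family_collinear[OF p e, of \<phi>])
  ultimately show ?thesis
    using segment_contact_point[of u "1 / r x1" "1 / r x2" "F \<phi> x1"] by simp
qed

text \<open>As the circle vertex is interior, the faces across its two sides supply the second
  \<open>Sph\<close> neighbours of \<open>y\<close> and \<open>y'\<close>. The opposite signs come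
  from the alternating labels.\<close>

lemma contacts_in_face:
  assumes f: "f \<in> faces Q" and z: "interior_vertex Q (corner Q f i)" "kind (corner Q f i) = Circ"
  defines "x \<equiv> corner Q f (i + 2)" and "y \<equiv> corner Q f (i + 1)" and "y' \<equiv> corner Q f (i - 1)"
  shows "contacts \<phi> y
      = {F \<phi> x - (lab (side Q f i) / (r x)\<^sup>2) *\<^sub>R tangent_rotation (K y) \<phi> (K y - K x)}"
    and "contacts \<phi> y'
      = {F \<phi> x + (lab (side Q f i) / (r x)\<^sup>2) *\<^sub>R tangent_rotation (K y') \<phi> (K y' - K x)}"
proof -
  obtain g j h k where gl: "glued Q (f, i) (g, j)" "glued Q (f, i - 1) (h, k)"
    using z(1) f unfolding interior_vertex_def by fast
  have i2: "i - 1 - 1 = i + 2" and i3: "i + 2 + 1 = i - 1" by (simp_all add: algebra_simps)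
  have "neighbour_pair Q kind Sph y x (corner Q g (j - 1))"
    using neighbour_pair_of_glued_faces[OF S gl(1) z(2)] by (simp add: x_def y_def)
  moreover have "joins Q (side Q f (i + 1)) y x"
    using joins_side[OF f, of "i + 1"] by (simp add: x_def y_def add.assoc)
  ultimately show "contacts \<phi> y
      = {F \<phi> x - (lab (side Q f i) / (r x)\<^sup>2) *\<^sub>R tangent_rotation (K y) \<phi> (K y - K x)}"
    using contacts_of_pair lab_side_add_one[OF f, of i] by fastforce
  have c: "corner Q f (i - 1) = corner Q h (k + 1)" "corner Q f i = corner Q h k"
    using glued_corners[OF quad gl(2)] glued_corners[OF quad glued_sym[OF gl(2)]] by simp_all
  \<comment> \<open>The faces exchange roles: side \<open>i - 1\<close> of \<open>f\<close> ends at
    the circle vertex, whereas side \<open>k\<close> of \<open>h\<close> starts there.\<close>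
  have "neighbour_pair Q kind Sph y' (corner Q h (k + 2)) x"
    using neighbour_pair_of_glued_faces[OF S glued_sym[OF gl(2)]] z(2) c
    unfolding i2 by (simp add: x_def y'_def)
  then have "neighbour_pair Q kind Sph y' x (corner Q h (k + 2))"
    by (simp only: neighbour_pair_commute)
  moreover have "joins Q (side Q f (i + 2)) y' x"
    using joins_side[OF f, of "i + 2"] unfolding i3 x_def y'_def by (simp only: joins_commute)
  moreover have "lab (side Q f (i + 2)) = lab (side Q f i)"
    using lab_side_add_one[OF f, of i] lab_side_add_one[OF f, of "i + 1"] by (simp add: add.assoc)
  ultimately show "contacts \<phi> y'
      = {F \<phi> x + (lab (side Q f i) / (r x)\<^sup>2) *\<^sub>R tangent_rotation (K y') \<phi> (K y' - K x)}"
    using contacts_of_pair by metis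
qed

section \<open>Comparison of the contact points around a circle vertex with
  \<open>F0\<close>\<close>

lemma dual_step:
  assumes "joins Q e a b"
  shows "F0 b - F0 a = (lab e / (norm (K b - K a))\<^sup>2) *\<^sub>R (K b - K a)"
  using assms dual unfolding s_isothermic_minimal_def by blast

text \<open>The quadrilateral of contact points of \<open>F\<^sub>\<phi>\<close> around a circle vertex is the image of that of
  \<open>F0\<close> under one fixed similarity.\<close>

lemma contact_difference:
  assumes f: "f \<in> faces Q" and z: "interior_vertex Q (corner Q f i)" "kind (corner Q f i) = Circ"
  defines "y \<equiv> corner Q f (i + 1)" and "y' \<equiv> corner Q f (i - 1)"
  obtains p p' where "contacts \<phi> y = {p}" "contacts \<phi> y' = {p'}"
    "p' - p = tangent_rotation (K (corner Q f i)) \<phi> (F0 y' - F0 y)"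
proof -
  define z where "z = corner Q f i"
  define x where "x = corner Q f (i + 2)"
  define a where "a = lab (side Q f i)"
  \<comment> \<open>Up to sign, \<open>c\<close> and \<open>d\<close> are the factors by which
    dualizing scales the edges at \<open>x\<close> and at \<open>z\<close>.\<close>
  define c where "c = 1 / (r x)\<^sup>2"
  define d where "d = 1 / (r z)\<^sup>2"
  have i3: "i + 2 + 1 = i - 1" by (simp add: algebra_simps)
  note kinds = face_kinds[OF S f z(2), folded x_def y_def y'_def]
  have lab: "lab (side Q f (i + 1)) = - a" "lab (side Q f (i + 2)) = a" "lab (side Q f (i - 1)) = - a"
    using lab_side_add_one[OF f, of i] lab_side_add_one[OF f, of "i + 1"] lab_side_add_one[OF f, of "i - 1"]
    by (simp_all add: a_def add.assoc)
  have j: "joins Q (side Q f i) z y" "joins Q (side Q f (i + 1)) y x"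
    "joins Q (side Q f (i + 2)) x y'" "joins Q (side Q f (i - 1)) y' z"
    using joins_side[OF f, of i] joins_side[OF f, of "i + 1"] joins_side[OF f, of "i + 2"]
      joins_side[OF f, of "i - 1"] unfolding i3
    by (simp_all add: z_def y_def x_def y'_def add.assoc)
  have j': "joins Q (side Q f (i + 2)) y' x" "joins Q (side Q f (i - 1)) z y'"
    using j(3,4) by (simp_all only: joins_commute)
  have kz: "kind z = Circ" using z(2) by (simp add: z_def)
  have "norm (K x - K y) = r x" "norm (K y' - K x) = r x"
    using sph_edge(2)[OF j(2) kinds(1,2)] sph_edge(2)[OF j'(1) kinds(3,2)]
    by (simp_all add: dist_norm norm_minus_commute)
  then have d0: "F0 y - F0 z = (a * d) *\<^sub>R (K y - K z)" "F0 x - F0 y = (- a * c) *\<^sub>R (K x - K y)"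
    "F0 y' - F0 x = (a * c) *\<^sub>R (K y' - K x)" "F0 y' - F0 z = (- a * d) *\<^sub>R (K y' - K z)"
    using dual_step[OF j(1)] dual_step[OF j(2)] dual_step[OF j(3)] dual_step[OF j'(2)]
      circ_edge(1)[OF j(1) kinds(1) kz] circ_edge(1)[OF j'(2) kinds(3) kz]
    by (simp_all add: lab c_def d_def flip: a_def)
  have a: "a \<noteq> 0" using abs_lab[OF j(1)] by (auto simp: a_def)
  have rz: "r z > 0"
    using koebe kz joins_vertsD[OF j(1)] unfolding koebe_polyhedron_def by blast
  have pos: "c > 0" "d > 0"
    using rz sph_radius_pos[OF j(2) kinds(2)] by (simp_all add: c_def d_def)
  \<comment> \<open>The increments of \<open>F0\<close> around the face cancel; divided by the sign
    \<open>a\<close>, this is the hypothesis of \<open>rotated_kite\<close>.\<close>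
  have "(F0 y - F0 z) + (F0 x - F0 y) + (F0 y' - F0 x) - (F0 y' - F0 z) = 0" by simp
  then have "a *\<^sub>R (d *\<^sub>R ((K y - K z) + (K y' - K z)) + c *\<^sub>R ((K y - K x) + (K y' - K x))) = 0"
    unfolding d0 by (simp add: algebra_simps)
  then have closing: "d *\<^sub>R ((K y - K z) + (K y' - K z)) + c *\<^sub>R ((K y - K x) + (K y' - K x)) = 0"
    using a by simp
  let ?p = "F \<phi> x - (a * c) *\<^sub>R tangent_rotation (K y) \<phi> (K y - K x)"
  let ?p' = "F \<phi> x + (a * c) *\<^sub>R tangent_rotation (K y') \<phi> (K y' - K x)"
  have "?p' - ?p = a *\<^sub>R (c *\<^sub>R (tangent_rotation (K y') \<phi> (K y' - K x) + tangent_rotation (K y) \<phi> (K y - K x)))"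
    by (simp add: scaleR_add_right)
  also have "\<dots> = (- a * d) *\<^sub>R tangent_rotation (K z) \<phi> ((K y - K z) + (K y' - K z))"
    unfolding rotated_kite[OF pos closing] by simp
  also have "\<dots> = tangent_rotation (K z) \<phi> ((- a * d) *\<^sub>R ((K y - K z) + (K y' - K z)))"
    by (rule tangent_rotation_scaleR[symmetric])
  \<comment> \<open>The two edges at \<open>z\<close> carry opposite labels, so the sum of their
    Koebe vectors becomes a difference of \<open>F0\<close> increments.\<close>
  also have "(- a * d) *\<^sub>R ((K y - K z) + (K y' - K z)) = (F0 y' - F0 z) - (F0 y - F0 z)"
    unfolding d0
    by (simp only: scaleR_add_right mult_minus_left scaleR_minus_left diff_conv_add_uminus
        minus_add_distrib add_ac)
  finally have "?p' - ?p = tangent_rotation (K z) \<phi> (F0 y' - F0 y)" by simp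
  moreover have "contacts \<phi> y = {?p}" "contacts \<phi> y' = {?p'}"
    using contacts_in_face[OF f z, folded x_def y_def y'_def a_def]
    by (simp_all add: c_def)
  ultimately show ?thesis using that by (simp add: z_def)
qed

text \<open>The translation \<open>C y\<close> takes the same value at both black neighbours of
  \<open>z\<close> in a face. Adjacent faces share such a neighbour, and the corners at
  \<open>z\<close> are linked by gluings, so one translation serves all of them.\<close>

lemma contacts_around_circle:
  assumes z: "interior_vertex Q z" "kind z = Circ"
  shows "\<exists>m. \<forall>e y. joins Q e z y \<longrightarrow>
    contacts \<phi> y = {m + tangent_rotation (K z) \<phi> (F0 y - F0 z)}"
proof -
  let ?A = "tangent_rotation (K z) \<phi>"
  define C where "C y = the_elem (contacts \<phi> y) - ?A (F0 y - F0 z)" for y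
  define G where "G c = C (corner Q (fst c) (snd c + 1))" for c :: "'f \<times> 4"
  have face: "contacts \<phi> (corner Q f (i + 1)) = {G (f, i) + ?A (F0 (corner Q f (i + 1)) - F0 z)}"
    "contacts \<phi> (corner Q f (i - 1)) = {G (f, i) + ?A (F0 (corner Q f (i - 1)) - F0 z)}"
    "C (corner Q f (i - 1)) = G (f, i)"
    if f: "f \<in> faces Q" "corner Q f i = z" for f i
  proof -
    let ?y = "corner Q f (i + 1)" and ?y' = "corner Q f (i - 1)"
    obtain p p' where p: "contacts \<phi> ?y = {p}" "contacts \<phi> ?y' = {p'}"
      "p' - p = ?A (F0 ?y' - F0 ?y)"
      using contact_difference[OF f(1), of i \<phi>] z f(2) by metis
    have "?A (F0 ?y' - F0 ?y) = ?A (F0 ?y' - F0 z) - ?A (F0 ?y - F0 z)"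
      by (simp flip: tangent_rotation_diff)
    then have "C ?y' = C ?y" using p by (simp add: C_def algebra_simps)
    then have C: "C ?y' = G (f, i)" "C ?y = G (f, i)" by (simp_all add: G_def)
    then show "C ?y' = G (f, i)" by simp
    from C show "contacts \<phi> ?y = {G (f, i) + ?A (F0 ?y - F0 z)}"
      "contacts \<phi> ?y' = {G (f, i) + ?A (F0 ?y' - F0 z)}"
      using p by (simp_all add: C_def algebra_simps)
  qed
  obtain f0 i0 where f0: "f0 \<in> faces Q" "corner Q f0 i0 = z"
    using z(1) unfolding interior_vertex_def verts_def by blast
  have step: "G c = G d"
    if cd: "corner_glued Q c d" and cz: "corner Q (fst c) (snd c) = z \<or> corner Q (fst d) (snd d) = z" for c d
  proof -
    obtain f i g j where c: "c = (f, i)" "d = (g, j)" by (metis surj_pair)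
    have gl: "glued Q (f, i) (g, j - 1)" using cd c by (simp add: corner_glued_def)
    \<comment> \<open>The black end of the glued side is corner \<open>i + 1\<close> of
      \<open>f\<close> and corner \<open>j - 1\<close> of \<open>g\<close>, so
      \<open>face(3)\<close> carries the value across.\<close>
    have "corner Q f i = corner Q g j" "corner Q f (i + 1) = corner Q g (j - 1)"
      using glued_corners[OF quad gl] glued_corners[OF quad glued_sym[OF gl]] by simp_all
    moreover have "g \<in> faces Q" using gl by (simp add: glued_def)
    ultimately show ?thesis using face(3)[of g j] cz c by (auto simp: G_def)
  qed
  have const: "G c = G (f0, i0)" if "equivclp (corner_glued Q) (f0, i0) c" for c
  proof -
    have faces: "fst d \<in> faces Q \<and> fst e \<in> faces Q \<and> corner Q (fst d) (snd d) = corner Q (fst e) (snd e)"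
      if "corner_glued Q d e" for d e
    proof -
      have "glued Q (fst d, snd d) (fst e, snd e - 1)" using that by (simp add: corner_glued_def)
      from glued_corners[OF quad this] this show ?thesis by (simp add: glued_def)
    qed
    from that have "corner Q (fst c) (snd c) = z \<and> G c = G (f0, i0)"
    proof (induction rule: equivclp_induct)
      case base
      show ?case using f0 by simp
    next
      case (step d e)
      then show ?case using faces[of d e] faces[of e d] \<open>\<And>d c. corner_glued Q c d \<Longrightarrow> _ \<Longrightarrow> G c = G d\<close> by metis
    qed
    then show ?thesis by simp
  qed
  have "contacts \<phi> y = {G (f0, i0) + ?A (F0 y - F0 z)}" if e: "joins Q e z y" for e y
  proof -
    obtain f i where f: "f \<in> faces Q" "{corner Q f i, corner Q f (i + 1)} = {z, y}"
      using e unfolding joins_def by blast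
    have at_z: "G (f, k) = G (f0, i0)" if "corner Q f k = z" for k
      by (rule const) (use corner_eq_iff[OF quad f0(1) f(1), of i0 k] f0(2) that in simp)
    from f(2) consider "corner Q f i = z" "corner Q f (i + 1) = y" | "corner Q f (i + 1) = z" "corner Q f i = y"
      by (auto simp: doubleton_eq_iff)
    then show ?thesis
    proof cases
      case 1
      then show ?thesis using face(1)[OF f(1) 1(1)] at_z by simp
    next
      case 2
      then show ?thesis using face(2)[OF f(1) 2(1)] at_z by simp
    qed
  qed
  then show ?thesis by blast
qed

text \<open>\<open>K z\<close> is a multiple of \<open>n z\<close>, so the map preserves the plane
  orthogonal to \<open>n z\<close> and scales it uniformly; there the vectors
  \<open>F0 y - F0 z\<close> all have length \<open>1 / r z\<close>.\<close>

lemma contact_circle: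
  assumes z: "interior_vertex Q z" "kind z = Circ"
  shows "\<exists>m \<rho>. \<rho> > 0 \<and> (\<forall>e y. joins Q e z y \<longrightarrow> (\<exists>p \<in> circle m (n z) \<rho>. contacts \<phi> y = {p}))"
proof -
  let ?A = "tangent_rotation (K z) \<phi>"
  \<comment> \<open>The squared scaling factor; it vanishes exactly when
    \<open>cos \<phi> = 0\<close> and \<open>K z = 0\<close>.\<close>
  define s where "s = (cos \<phi>)\<^sup>2 + (sin \<phi>)\<^sup>2 * (norm (K z))\<^sup>2"
  obtain m where m: "\<And>e y. joins Q e z y \<Longrightarrow> contacts \<phi> y = {m + ?A (F0 y - F0 z)}"
    using contacts_around_circle[OF z] by metis
  have "z \<in> verts Q" using z(1) by (simp add: interior_vertex_def)
  then have rz: "r z > 0" and nz: "norm (n z) = 1" and sub: "circle (K z) (n z) (r z) \<subseteq> sphere 0 1"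
    using koebe z(2) unfolding koebe_polyhedron_def by blast+
  have center: "K z = (n z \<bullet> K z) *\<^sub>R n z"
    by (rule circle_in_unit_sphere_center[OF nz rz sub])
  have A: "n z \<bullet> ?A (F0 y - F0 z) = 0" "(norm (?A (F0 y - F0 z)))\<^sup>2 = s / (r z)\<^sup>2"
    if e: "joins Q e z y" for e y
  proof -
    let ?v = "F0 y - F0 z"
    have y: "kind y = Black" using S e z(2) unfolding S_quad_graph_def by (metis vertex_kind.distinct(1))
    note circ = circ_edge[OF e y z(2)]
    have v: "?v = (lab e / (r z)\<^sup>2) *\<^sub>R (K y - K z)" using dual_step[OF e] circ(1) by simp
    then have nv: "n z \<bullet> ?v = 0" using circ(2) by simp
    have "norm ?v = 1 / r z"
      unfolding v using abs_lab[OF e] circ(1) rz by (simp add: power2_eq_square)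
    moreover have "K z \<bullet> ?v = 0" by (subst center) (simp add: nv)
    ultimately show "(norm (?A ?v))\<^sup>2 = s / (r z)\<^sup>2"
      using norm_tangent_rotation[of "K z" ?v \<phi>] by (simp add: s_def power_divide)
    have "n z \<bullet> cross3 (K z) ?v = 0"
      by (subst center) (simp add: cross_mult_left dot_cross_self)
    then show "n z \<bullet> ?A ?v = 0" by (simp add: tangent_rotation_def inner_add_right nv)
  qed
  have "s \<ge> 0" by (simp add: s_def)
  show ?thesis
  proof (cases "s = 0")
    case True
    \<comment> \<open>Every contact point is \<open>m\<close>, so any circle through
      \<open>m\<close> with normal \<open>n z\<close> will do.\<close>
    obtain m' \<rho> where c: "\<rho> > 0" "m \<in> circle m' (n z) \<rho>" by (rule ex_circle_through_point)
    have "contacts \<phi> y = {m}" if "joins Q e z y" for e y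
      using m[OF that] A(2)[OF that] True by simp
    then show ?thesis using c by blast
  next
    case False
    have "m + ?A (F0 y - F0 z) \<in> circle m (n z) (sqrt s / r z)" if e: "joins Q e z y" for e y
    proof -
      have "norm (?A (F0 y - F0 z)) = sqrt (s / (r z)\<^sup>2)"
        using A(2)[OF e] by (metis norm_ge_zero real_sqrt_unique)
      then show ?thesis using A(1)[OF e] rz by (simp add: circle_def dist_norm real_sqrt_divide)
    qed
    moreover have "sqrt s / r z > 0" using False \<open>s \<ge> 0\<close> rz by simp
    ultimately show ?thesis using m by blast
  qed
qed

end

theorem theorem8:
  fixes Q :: "('v, 'e, 'f) quad_cells"
    and kind :: "'v \<Rightarrow> vertex_kind"
    and lab :: "'e \<Rightarrow> real"
    and K :: "'v \<Rightarrow> real^3" and r :: "'v \<Rightarrow> real" and n :: "'v \<Rightarrow> real^3"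
    and F0 :: "'v \<Rightarrow> real^3"
    and F :: "real \<Rightarrow> 'v \<Rightarrow> real^3"
  assumes "S_quad_graph Q kind"
    and "simply_connected_cells Q"
    and "edge_labelling Q lab"
    and "koebe_polyhedron Q kind K r n"
    and "s_isothermic_minimal Q lab K F0"
    and "associated_family Q kind lab K r F"
  shows "\<exists>R :: 'v \<Rightarrow> real.
      (\<forall>x\<in>verts Q. kind x = Sph \<longrightarrow> R x > 0)
    \<and> (\<forall>\<phi> y x1 x2. neighbour_pair Q kind Sph y x1 x2 \<longrightarrow>
         (\<exists>p. touch_externally_at (F \<phi> x1) (R x1) (F \<phi> x2) (R x2) p))
    \<and> ((\<forall>v. interior_vertex Q v \<longrightarrow> degree Q v = 4) \<longrightarrow>
         (\<forall>z. interior_vertex Q z \<and> kind z = Circ \<longrightarrow>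
            (\<exists>n\<^sub>z. norm n\<^sub>z = 1 \<and>
               (\<forall>\<phi>. \<exists>m \<rho>. \<rho> > 0 \<and>
                  (\<forall>e y. joins Q e z y \<longrightarrow>
                     (\<exists>p \<in> circle m n\<^sub>z \<rho>. contact_points Q kind (F \<phi>) R y = {p}))))))"
proof -
  interpret koebe_associated_family Q kind lab K r n F0 F
    using assms by unfold_locales
  show ?thesis
  proof (intro exI[of _ "\<lambda>x. 1 / r x"] conjI impI allI ballI)
    show "1 / r x > 0" if "x \<in> verts Q" "kind x = Sph" for x
      using koebe that unfolding koebe_polyhedron_def by simp
    show "\<exists>p. touch_externally_at (F \<phi> x1) (1 / r x1) (F \<phi> x2) (1 / r x2) p"
      if "neighbour_pair Q kind Sph y x1 x2" for \<phi> y x1 x2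
      by (rule family_touches[OF that])
    \<comment> \<open>The normal of the Koebe circle at \<open>z\<close> is chosen before \<phi> and
      serves for the whole family.\<close>
    show "\<exists>n\<^sub>z. norm n\<^sub>z = 1 \<and> (\<forall>\<phi>. \<exists>m \<rho>. \<rho> > 0 \<and>
        (\<forall>e y. joins Q e z y \<longrightarrow> (\<exists>p \<in> circle m n\<^sub>z \<rho>. contacts \<phi> y = {p})))"
      if z: "interior_vertex Q z \<and> kind z = Circ" for z
    proof (rule exI[of _ "n z"], intro conjI allI)
      show "norm (n z) = 1"
        using koebe z unfolding koebe_polyhedron_def interior_vertex_def by blast
    qed (rule contact_circle; use z in simp)
  qed
qed

end
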